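(* Let $\omega$ be a modulus of continuity and let $I$ be a proper (nondegenerate) subinterval of $\mathbb{R}$. On $\operatorname{Lip}(\omega,I)$, the uncentered maximal operator $M$ on $I$ satisfies $$\|M\|_{\operatorname{Op}(\omega)}=\sup_{0<t<|I|}\frac1{\omega(t)}\int_0^1\omega(tu)\,du .$$ In the special case $\omega(t)=t^\alpha$, $\alpha\in(0,1]$, i.e. over the Hölder and Lipschitz classes, $$\|M\|_{\operatorname{Op}(\alpha)}=\frac1{1+\alpha}.$$
   Context: A proper subinterval $I$ of $\mathbb{R}$ is a nondegenerate interval (neither empty nor a single point; bounded or unbounded; open, closed or half-open) with $I\ne\mathbb{R}$; $|I|\in(0,\infty]$ is its length. For locally integrable $f:I\to\mathbb{R}$, the uncentered (local) maximal function is $Mf(x)=\sup\frac1{|J|}\int_J|f(y)|\,dy\in[0,\infty]$ for $x\in I$, the supremum being over all bounded nondegenerate intervals $J$ with $x\in J\subset I$. A modulus of continuity is a function $\omega:[0,\infty)\to[0,\infty)$ that is continuous, nondecreasing, subadditive, with $\omega(0)=0$, and not identically zero. For $f:I\to\mathbb{R}$ let $\|f\|_{\operatorname{Lip}(\omega,I)}=\sup_{x\ne y\in I}\frac{|f(x)-f(y)|}{\omega(|x-y|)}$; $\operatorname{Lip}(\omega,I)$ consists of the $f$ for which this is finite, and $$\|M\|_{\operatorname{Op}(\omega)}=\sup\Big\{\frac{\|Mf\|_{\operatorname{Lip}(\omega,I)}}{\|f\|_{\operatorname{Lip}(\omega,I)}}: f\in\operatorname{Lip}(\omega,I),\ \|f\|_{\operatorname{Lip}(\omega,I)}\ne0\Big\}.$$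 When $\omega(t)=t^\alpha$ this is denoted $\|M\|_{\operatorname{Op}(\alpha)}$. If $Mf\equiv\infty$, it is regarded as constant, i.e. $\|Mf\|_{\operatorname{Lip}(\omega,I)}=0$. *)

theory Defs
  imports "HOL-Analysis.Analysis"
begin

definition nondegenerate_interval :: "real set \<Rightarrow> bool" where
  "nondegenerate_interval J \<longleftrightarrow> is_interval J \<and> (\<exists>a\<in>J. \<exists>b\<in>J. a < b)"

definition proper_subinterval :: "real set \<Rightarrow> bool" where
  "proper_subinterval I \<longleftrightarrow> nondegenerate_interval I \<and> I \<noteq> UNIV"

(* Functions on I (and on [0,\<infinity>), for moduli of continuity) are total functions on the
   reals; every notion below depends only on their values on I (resp. on [0,\<infinity>)). *)

definition maximal_function :: "real set \<Rightarrow> (real \<Rightarrow> real) \<Rightarrow> real \<Rightarrow> ennreal" where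
  "maximal_function I f x =
     (SUP J\<in>{J. nondegenerate_interval J \<and> bounded J \<and> x \<in> J \<and> J \<subseteq> I}.
        (\<integral>\<^sup>+y\<in>J. ennreal \<bar>f y\<bar> \<partial>lborel) / emeasure lborel J)"

definition modulus_of_continuity :: "(real \<Rightarrow> real) \<Rightarrow> bool" where
  "modulus_of_continuity \<omega> \<longleftrightarrow>
     (\<forall>t\<ge>0. 0 \<le> \<omega> t) \<and>
     continuous_on {0..} \<omega> \<and>
     mono_on {0..} \<omega> \<and>
     (\<forall>s\<ge>0. \<forall>t\<ge>0. \<omega> (s + t) \<le> \<omega> s + \<omega> t) \<and>
     \<omega> 0 = 0 \<and>
     (\<exists>t\<ge>0. \<omega> t \<noteq> 0)"

(* Extended-real values are allowed so that the seminorm applies to maximal functions.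
   A function identically \<infinity> on I counts as constant.  If g takes both the value \<infinity> and
   finite values on I, the supremum is \<infinity>. *)
definition lip_seminorm :: "(real \<Rightarrow> real) \<Rightarrow> real set \<Rightarrow> (real \<Rightarrow> ereal) \<Rightarrow> ereal" where
  "lip_seminorm \<omega> I g =
     (if \<forall>x\<in>I. g x = \<infinity> then 0
      else SUP (x, y)\<in>{(x, y). x \<in> I \<and> y \<in> I \<and> x \<noteq> y}.
             \<bar>g x - g y\<bar> / ereal (\<omega> \<bar>x - y\<bar>))"

definition Lip :: "(real \<Rightarrow> real) \<Rightarrow> real set \<Rightarrow> (real \<Rightarrow> real) set" where
  "Lip \<omega> I = {f. lip_seminorm \<omega> I (\<lambda>x. ereal (f x)) < \<infinity>}"

definition maximal_op_norm :: "(real \<Rightarrow> real) \<Rightarrow> real set \<Rightarrow> ereal" where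
  "maximal_op_norm \<omega> I =
     (SUP f\<in>{f \<in> Lip \<omega> I. lip_seminorm \<omega> I (\<lambda>x. ereal (f x)) \<noteq> 0}.
        lip_seminorm \<omega> I (\<lambda>x. enn2ereal (maximal_function I f x)) /
        lip_seminorm \<omega> I (\<lambda>x. ereal (f x)))"

end

theory Submission
  imports Defs
begin

text \<open>Every average is written as a mean over the unit interval: the affine map u -> a + (b -
  a) u turns the average of |f| over an interval with endpoints a, b into the integral of |f (a + (b
  - a) u)| over 0 < u < 1 (\<open>average_eq\<close>). Averages over different intervals can then be
  compared pointwise in u.

  Upper bound. Let x < y, let J have endpoints a < b and contain x, and let f have seminorm L. If J
  contains y, its average already counts for Mf(y). Otherwise b <= y, and J is stretched to (a, y]
  with the left end fixed. The point of parameter u moves by t u with t = y - b <= y - x, so the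
  average drops by at most L times the mean of \<omega>(t u). If K bounds all quotients in the
  supremum, this loss is at most L K \<omega>(y - x). Since t < y - a <= |I|, only admissible t
  occur. Reflection handles y < x (\<open>maximal_function_diff\<close>), and
  \<open>maximal_op_norm_le\<close> follows.

  Lower bound. If c = Inf I is finite and 0 < t < |I|, take f equal to \<omega>(t) - \<omega>(s - c)
  for c <= s <= c + t and 0 beyond; its seminorm is at most 1. Since f is nonincreasing on I and no
  interval in I reaches left of c, Mf(c + t) is at most the average over (c, c + t), namely
  \<omega>(t) minus the mean of \<omega>(t u). Near c, Mf is at least almost \<omega>(t). Comparing
  c + r with c + t as r tends to 0 gives the quotient for t
  (\<open>maximal_op_norm_ge_bdd_below\<close>). A proper interval is bounded on some side, and
  \<open>maximal_op_norm_reflect\<close> makes it the left one.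

  For powers the quotient does not depend on t (\<open>powr_mean\<close>).\<close>

section \<open>Moduli of continuity\<close>

lemma modulus_of_continuityD:
  assumes "modulus_of_continuity \<omega>"
  shows modulus_nonneg: "t \<ge> 0 \<Longrightarrow> 0 \<le> \<omega> t"
    and modulus_mono: "0 \<le> s \<Longrightarrow> s \<le> t \<Longrightarrow> \<omega> s \<le> \<omega> t"
    and modulus_subadd: "0 \<le> s \<Longrightarrow> 0 \<le> t \<Longrightarrow> \<omega> (s + t) \<le> \<omega> s + \<omega> t"
    and modulus_zero: "\<omega> 0 = 0"
    and modulus_continuous: "continuous_on {0..} \<omega>"
  using assms by (auto simp: modulus_of_continuity_def mono_on_def)

text \<open>A positive zero of \<omega> would, by subadditivity, give zeros at all its multiples,
  and monotonicity would then make \<omega> vanish identically. Positivity makes every denominator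
  \<omega>(|x - y|) with x and y distinct harmless.\<close>

lemma modulus_pos:
  assumes "modulus_of_continuity \<omega>" "t > 0"
  shows "\<omega> t > 0"
proof (rule ccontr)
  assume "\<not> \<omega> t > 0"
  then have z: "\<omega> t = 0" using modulus_nonneg[OF assms(1), of t] assms(2) by auto
  have mult: "\<omega> (real n * t) = 0" for n
  proof (induction n)
    case 0
    show ?case using modulus_zero[OF assms(1)] by simp
  next
    case (Suc n)
    have "\<omega> (real n * t + t) \<le> \<omega> (real n * t) + \<omega> t"
      using assms(2) by (intro modulus_subadd[OF assms(1)]) auto
    moreover have "\<omega> (real n * t + t) \<ge> 0"
      using assms(2) by (intro modulus_nonneg[OF assms(1)]) auto
    ultimately show ?case using Suc z by (simp add: algebra_simps)
  qed
  have "\<omega> s = 0" if "s \<ge> 0" for s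
  proof -
    obtain n where "s < real n * t" using reals_Archimedean3[OF assms(2)] by blast
    then show ?thesis
      using modulus_mono[OF assms(1) that, of "real n * t"] mult[of n]
        modulus_nonneg[OF assms(1) that] by simp
  qed
  then show False using assms(1) by (auto simp: modulus_of_continuity_def)
qed

text \<open>This says that \<omega> has constant at most 1 in its own class, which is what bounds
  the seminorm of the extremal function.\<close>

lemma modulus_diff_le:
  assumes "modulus_of_continuity \<omega>" "s \<ge> 0" "t \<ge> 0"
  shows "\<bar>\<omega> s - \<omega> t\<bar> \<le> \<omega> \<bar>s - t\<bar>"
proof -
  have *: "\<bar>\<omega> s - \<omega> t\<bar> \<le> \<omega> \<bar>s - t\<bar>" if "s \<ge> 0" "s \<le> t" for s t
  proof -
    have "\<omega> (s + (t - s)) \<le> \<omega> s + \<omega> (t - s)"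
      using that by (intro modulus_subadd[OF assms(1)]) auto
    moreover have "\<omega> s \<le> \<omega> t" using that by (intro modulus_mono[OF assms(1)])
    ultimately show ?thesis using that by simp
  qed
  show ?thesis
    using *[of s t] *[of t s] assms(2,3) by (cases "s \<le> t") (auto simp: abs_minus_commute)
qed

lemma modulus_small:
  assumes "modulus_of_continuity \<omega>" "e > 0" "t > 0"
  obtains r where "0 < r" "r < t" "\<omega> r < e"
proof -
  have "continuous (at 0 within {0..}) \<omega>"
    using modulus_continuous[OF assms(1)] by (simp add: continuous_on_eq_continuous_within)
  then obtain d where d: "d > 0" "\<And>x. x \<ge> 0 \<Longrightarrow> dist x 0 < d \<Longrightarrow> dist (\<omega> x) (\<omega> 0) < e"
    using assms(2) unfolding continuous_within_eps_delta by (metis atLeast_iff)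
  define r where "r = min d t / 2"
  have r: "0 < r" "r < d" "r < t" using d(1) assms(3) by (auto simp: r_def min_def)
  have "dist (\<omega> r) (\<omega> 0) < e" using r by (intro d(2)) auto
  then show ?thesis using that r modulus_zero[OF assms(1)] by (simp add: dist_real_def)
qed

lemma modulus_scaled_continuous:
  assumes "modulus_of_continuity \<omega>" "t \<ge> 0"
  shows "continuous_on {0..1} (\<lambda>u. \<omega> (t * u))"
  by (rule continuous_on_compose2[OF modulus_continuous[OF assms(1)]])
     (use assms(2) in \<open>auto intro!: continuous_intros\<close>)

text \<open>By these bounds the quotients in the theorem lie in [0, 1], so their supremum is a real
  number.\<close>

lemma modulus_mean_bounds:
  assumes "modulus_of_continuity \<omega>" "t \<ge> 0"
  shows "0 \<le> integral {0..1} (\<lambda>u. \<omega> (t * u))"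
    and "integral {0..1} (\<lambda>u. \<omega> (t * u)) \<le> \<omega> t"
proof -
  have i: "(\<lambda>u. \<omega> (t * u)) integrable_on {0..1}"
    by (rule integrable_continuous_real[OF modulus_scaled_continuous[OF assms]])
  show "0 \<le> integral {0..1} (\<lambda>u. \<omega> (t * u))"
    using assms(2) by (intro integral_nonneg[OF i] modulus_nonneg[OF assms(1)]) auto
  have "integral {0..1} (\<lambda>u. \<omega> (t * u)) \<le> integral {0..1} (\<lambda>u::real. \<omega> t)"
    using assms(2)
    by (intro integral_le[OF i] modulus_mono[OF assms(1)]) (auto simp: mult_left_le)
  then show "integral {0..1} (\<lambda>u. \<omega> (t * u)) \<le> \<omega> t" by simp
qed

text \<open>Subadditivity comes from scaling s + t to 1: on [0, 1] the power dominates the identity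
  because \<alpha> <= 1.\<close>

lemma modulus_powr:
  assumes "0 < \<alpha>" "\<alpha> \<le> 1"
  shows "modulus_of_continuity (\<lambda>t. t powr \<alpha>)"
proof -
  have sub: "(s + t) powr \<alpha> \<le> s powr \<alpha> + t powr \<alpha>" if "s \<ge> 0" "t \<ge> 0" for s t :: real
  proof (cases "s + t = 0")
    case True
    then show ?thesis using that by simp
  next
    case False
    then have p: "s + t > 0" using that by simp
    have ge: "x \<le> x powr \<alpha>" if "0 \<le> x" "x \<le> 1" for x :: real
      using powr_mono'[of \<alpha> 1 x] that assms by (cases "x = 0") auto
    have "1 = s / (s + t) + t / (s + t)" using p by (simp add: add_divide_distrib[symmetric])
    also have "\<dots> \<le> (s / (s + t)) powr \<alpha> + (t / (s + t)) powr \<alpha>"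
      using that p by (intro add_mono ge) auto
    also have "\<dots> = (s powr \<alpha> + t powr \<alpha>) / (s + t) powr \<alpha>"
      using that p by (simp add: powr_divide add_divide_distrib)
    finally show ?thesis using p by (simp add: field_simps)
  qed
  have "(1::real) powr \<alpha> \<noteq> 0" by simp
  moreover have "continuous_on {0..} (\<lambda>t::real. t powr \<alpha>)"
    using assms by (intro continuous_on_powr') (auto intro!: continuous_intros)
  ultimately show ?thesis
    unfolding modulus_of_continuity_def mono_on_def
    using assms sub by (auto intro!: powr_mono2 exI[of _ "1::real"])
qed

section \<open>Averages over intervals\<close>

text \<open>Treats open, closed and half-open intervals uniformly: J is known up to its two
  endpoints, which have measure zero.\<close>

lemma interval_endpoints:
  assumes "nondegenerate_interval J" "bounded J"
  obtains a b where "a < b" "{a<..<b} \<subseteq> J" "J \<subseteq> {a..b}"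
proof -
  from assms(1) obtain p q where pq: "p \<in> J" "q \<in> J" "p < q" and i: "is_interval J"
    by (auto simp: nondegenerate_interval_def)
  have bb: "bdd_below J" "bdd_above J" using assms(2)
    by (auto simp: bounded_imp_bdd_below bounded_imp_bdd_above)
  have sub: "J \<subseteq> {Inf J..Sup J}" using bb by (auto intro: cInf_lower cSup_upper)
  have "{Inf J<..<Sup J} \<subseteq> J"
  proof
    fix z assume z: "z \<in> {Inf J<..<Sup J}"
    obtain x where "x \<in> J" "x < z" using z pq cInf_lessD[of J z] by auto
    moreover obtain y where "y \<in> J" "z < y" using z pq less_cSupD[of J z] by auto
    ultimately show "z \<in> J" using i unfolding is_interval_1 by (meson less_imp_le)
  qed
  moreover have "Inf J \<le> p" "q \<le> Sup J" using pq sub by auto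
  then have "Inf J < Sup J" using pq(3) by linarith
  ultimately show ?thesis using sub that by blast
qed

lemma nondegenerate_interval_sandwich:
  assumes "a < b" "{a<..<b} \<subseteq> J" "J \<subseteq> {a..b}"
  shows "nondegenerate_interval J" "bounded J"
proof -
  have "x \<in> J" if "p \<in> J" "q \<in> J" "p \<le> x" "x \<le> q" for p q x
  proof (cases "x = p \<or> x = q")
    case False
    then have "x \<in> {a<..<b}" using that assms(3) by force
    then show ?thesis using assms(2) by blast
  qed (use that in auto)
  then have "is_interval J" unfolding is_interval_1 by blast
  moreover obtain p where p: "a < p" "p < b" using dense[OF assms(1)] by blast
  moreover obtain q where q: "p < q" "q < b" using dense[OF p(2)] by blast
  moreover have "p \<in> J" "q \<in> J" using p q assms(2) by auto
  ultimately show "nondegenerate_interval J" unfolding nondegenerate_interval_def by blast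
  show "bounded J" using assms(3) bounded_closed_interval bounded_subset by blast
qed

text \<open>Nothing is known about f outside J, so only the product with the indicator can be
  claimed to be measurable.\<close>

lemma borel_measurable_abs_indicator:
  fixes f :: "real \<Rightarrow> real"
  assumes "J \<in> sets borel" "continuous_on J f"
  shows "(\<lambda>y. ennreal \<bar>f y\<bar> * indicator J y) \<in> borel_measurable borel"
proof -
  have "(\<lambda>y. indicator J y *\<^sub>R f y) \<in> borel_measurable borel"
    by (rule borel_measurable_continuous_on_indicator[OF assms])
  then have "(\<lambda>y. ennreal \<bar>indicator J y *\<^sub>R f y\<bar>) \<in> borel_measurable borel"
    by measurable
  also have "(\<lambda>y. ennreal \<bar>indicator J y *\<^sub>R f y\<bar>) = (\<lambda>y. ennreal \<bar>f y\<bar> * indicator J y)"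
    by (auto simp: indicator_def)
  finally show ?thesis .
qed

text \<open>The affine substitution y = a + (b - a) u cancels the length and gives all averages the
  same domain. The sandwich for J suffices since endpoints are null sets.\<close>

lemma average_eq:
  fixes f :: "real \<Rightarrow> real"
  assumes "a < b" "{a<..<b} \<subseteq> J" "J \<subseteq> {a..b}" "continuous_on {a<..<b} f"
  shows "(\<integral>\<^sup>+y\<in>J. ennreal \<bar>f y\<bar> \<partial>lborel) / emeasure lborel J =
         (\<integral>\<^sup>+u\<in>{0<..<1}. ennreal \<bar>f (a + (b - a) * u)\<bar> \<partial>lborel)"
proof -
  have ni: "is_interval J"
    using nondegenerate_interval_sandwich[OF assms(1-3)] by (simp add: nondegenerate_interval_def)
  have meas: "J \<in> sets lborel" using real_interval_borel_measurable[OF ni] by simp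
  have "emeasure lborel {a<..<b} \<le> emeasure lborel J"
    by (rule emeasure_mono[OF assms(2) meas])
  moreover have "emeasure lborel J \<le> emeasure lborel {a..b}"
    by (rule emeasure_mono[OF assms(3)]) simp
  ultimately have em: "emeasure lborel J = ennreal (b - a)" using assms(1) by auto
  have "(\<integral>\<^sup>+y\<in>J. ennreal \<bar>f y\<bar> \<partial>lborel) = (\<integral>\<^sup>+y\<in>{a<..<b}. ennreal \<bar>f y\<bar> \<partial>lborel)"
  proof (rule nn_integral_cong_AE)
    show "AE y in lborel. ennreal \<bar>f y\<bar> * indicator J y = ennreal \<bar>f y\<bar> * indicator {a<..<b} y"
      using AE_lborel_singleton[of a] AE_lborel_singleton[of b]
    proof eventually_elim
      case (elim y)
      then have "y \<in> J \<longleftrightarrow> y \<in> {a<..<b}" using assms(2,3) by force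
      then show ?case by (simp add: indicator_def)
    qed
  qed
  also have "\<dots> = ennreal \<bar>b - a\<bar> * (\<integral>\<^sup>+u. ennreal \<bar>f (a + (b - a) * u)\<bar> *
        indicator {a<..<b} (a + (b - a) * u) \<partial>lborel)"
    using assms(1,4) by (intro nn_integral_real_affine borel_measurable_abs_indicator) auto
  also have "(\<lambda>u. indicator {a<..<b} (a + (b - a) * u) :: ennreal) = indicator {0<..<1}"
  proof
    fix u
    have "a < a + (b - a) * u \<longleftrightarrow> 0 < u" using assms(1) by (simp add: zero_less_mult_iff)
    moreover have "a + (b - a) * u < b \<longleftrightarrow> u < 1"
      using mult_less_cancel_left_pos[of "b - a" u 1] assms(1) by (smt (verit))
    ultimately show "indicator {a<..<b} (a + (b - a) * u) = (indicator {0<..<1} u :: ennreal)"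
      by (simp only: indicator_def greaterThanLessThan_iff)
  qed
  finally have "(\<integral>\<^sup>+y\<in>J. ennreal \<bar>f y\<bar> \<partial>lborel) =
      (\<integral>\<^sup>+u\<in>{0<..<1}. ennreal \<bar>f (a + (b - a) * u)\<bar> \<partial>lborel) * ennreal (b - a)"
    using assms(1) by (simp add: mult.commute)
  then show ?thesis using assms(1) em by (simp add: ennreal_mult_divide_eq)
qed

text \<open>Links the nonnegative Lebesgue integral in the maximal function with the gauge integral
  of \<omega> in the theorem.\<close>

lemma nn_integral_unit_interval:
  fixes g :: "real \<Rightarrow> real"
  assumes "continuous_on {0..1} g" "\<And>u. u \<in> {0..1} \<Longrightarrow> 0 \<le> g u"
  shows "(\<integral>\<^sup>+u\<in>{0<..<1}. ennreal (g u) \<partial>lborel) = ennreal (integral {0..1} g)"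
proof -
  have "(g has_integral integral {0..1} g) {0<..<1}"
    using integrable_integral[OF integrable_continuous_real[OF assms(1)]]
    by (simp add: has_integral_Icc_iff_Ioo)
  then show ?thesis
    using assms(2) by (intro nn_integral_has_integral_lebesgue') auto
qed

text \<open>With \<open>maximal_function_le\<close>, this restates the supremum through
  unit-interval means. The set J is kept besides a and b because x may be an endpoint belonging to
  J.\<close>

lemma maximal_function_ge:
  fixes f :: "real \<Rightarrow> real"
  assumes "a < b" "{a<..<b} \<subseteq> J" "J \<subseteq> {a..b}" "x \<in> J" "J \<subseteq> I" "continuous_on I f"
  shows "(\<integral>\<^sup>+u\<in>{0<..<1}. ennreal \<bar>f (a + (b - a) * u)\<bar> \<partial>lborel) \<le> maximal_function I f x"
proof -
  have "continuous_on {a<..<b} f" using assms by (blast intro: continuous_on_subset)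
  note eq = average_eq[OF assms(1-3) this, symmetric]
  show ?thesis unfolding eq maximal_function_def
    using nondegenerate_interval_sandwich[OF assms(1-3)] assms(4,5) by (intro SUP_upper) auto
qed

lemma maximal_function_le:
  fixes f :: "real \<Rightarrow> real"
  assumes "continuous_on I f"
    and "\<And>a b J. a < b \<Longrightarrow> {a<..<b} \<subseteq> J \<Longrightarrow> J \<subseteq> {a..b} \<Longrightarrow> x \<in> J \<Longrightarrow> J \<subseteq> I \<Longrightarrow>
        (\<integral>\<^sup>+u\<in>{0<..<1}. ennreal \<bar>f (a + (b - a) * u)\<bar> \<partial>lborel) \<le> B"
  shows "maximal_function I f x \<le> B"
  unfolding maximal_function_def
proof (rule SUP_least)
  fix J assume "J \<in> {J. nondegenerate_interval J \<and> bounded J \<and> x \<in> J \<and> J \<subseteq> I}"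
  then have J: "nondegenerate_interval J" "bounded J" "x \<in> J" "J \<subseteq> I" by auto
  obtain a b where ab: "a < b" "{a<..<b} \<subseteq> J" "J \<subseteq> {a..b}" by (rule interval_endpoints[OF J(1,2)])
  have "continuous_on {a<..<b} f" using ab J assms(1) by (blast intro: continuous_on_subset)
  from average_eq[OF ab this] assms(2)[OF ab J(3,4)]
  show "(\<integral>\<^sup>+y\<in>J. ennreal \<bar>f y\<bar> \<partial>lborel) / emeasure lborel J \<le> B" by simp
qed

section \<open>Reflection\<close>

lemma mem_uminus_image: "(x::real) \<in> uminus ` I \<longleftrightarrow> - x \<in> I"
  by (metis add.inverse_inverse image_iff)

lemma nondegenerate_interval_reflect:
  assumes "nondegenerate_interval J"
  shows "nondegenerate_interval (uminus ` J)"
proof -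
  obtain a b where "a \<in> J" "b \<in> J" "a < b" and i: "is_interval J"
    using assms by (auto simp: nondegenerate_interval_def)
  then have "- b \<in> uminus ` J" "- a \<in> uminus ` J" "- b < - a" by auto
  moreover have "is_interval (uminus ` J)" using i by simp
  ultimately show ?thesis unfolding nondegenerate_interval_def by blast
qed

lemma emeasure_lborel_reflect:
  fixes J :: "real set"
  assumes "J \<in> sets borel"
  shows "emeasure lborel (uminus ` J) = emeasure lborel J"
proof -
  have "uminus -` J = uminus ` J" by (auto simp: mem_uminus_image)
  then show ?thesis
    using assms emeasure_distr[of "uminus" lborel borel J] lborel_distr_uminus by simp
qed

text \<open>Reflection maps the admissible J to the admissible -J with the same average. One
  inequality suffices, since reflecting twice is the identity.\<close>

lemma maximal_function_reflect:
  fixes f :: "real \<Rightarrow> real"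
  assumes "continuous_on I f"
  shows "maximal_function (uminus ` I) (\<lambda>y. f (- y)) (- x) = maximal_function I f x"
proof -
  have le: "maximal_function I f x \<le> maximal_function (uminus ` I) (\<lambda>y. f (- y)) (- x)"
    if c: "continuous_on I f" for I f x
    unfolding maximal_function_def
  proof (rule SUP_mono)
    fix J assume "J \<in> {J. nondegenerate_interval J \<and> bounded J \<and> x \<in> J \<and> J \<subseteq> I}"
    then have J: "nondegenerate_interval J" "bounded J" "x \<in> J" "J \<subseteq> I" by auto
    have m: "J \<in> sets borel" using J(1) real_interval_borel_measurable by (auto simp: nondegenerate_interval_def)
    have "continuous_on J f" using c J(4) continuous_on_subset by blast
    from nn_integral_real_affine[OF borel_measurable_abs_indicator[OF m this], of "-1" 0]
    have "(\<integral>\<^sup>+y\<in>J. ennreal \<bar>f y\<bar> \<partial>lborel) = (\<integral>\<^sup>+y\<in>uminus ` J. ennreal \<bar>f (- y)\<bar> \<partial>lborel)"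
      by (simp add: indicator_def mem_uminus_image)
    then show "\<exists>K\<in>{K. nondegenerate_interval K \<and> bounded K \<and> - x \<in> K \<and> K \<subseteq> uminus ` I}.
        (\<integral>\<^sup>+y\<in>J. ennreal \<bar>f y\<bar> \<partial>lborel) / emeasure lborel J
        \<le> (\<integral>\<^sup>+y\<in>K. ennreal \<bar>f (- y)\<bar> \<partial>lborel) / emeasure lborel K"
      using J nondegenerate_interval_reflect[OF J(1)] emeasure_lborel_reflect[OF m]
      by (intro bexI[of _ "uminus ` J"]) auto
  qed
  have "continuous_on (uminus ` I) (\<lambda>y. f (- y))"
    by (rule continuous_on_compose2[OF assms]) (auto intro!: continuous_intros)
  from le[OF this, of "- x"] le[OF assms, of x] show ?thesis
    by (simp add: image_image)
qed

lemma lip_seminorm_reflect: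
  "lip_seminorm \<omega> (uminus ` I) (\<lambda>x. g (- x)) = lip_seminorm \<omega> I g"
proof -
  have le: "lip_seminorm \<omega> I g \<le> lip_seminorm \<omega> (uminus ` I) (\<lambda>x. g (- x))" for I g
  proof (cases "\<forall>x\<in>I. g x = \<infinity>")
    case True
    then show ?thesis by (simp add: lip_seminorm_def)
  next
    case False
    show ?thesis using False
      by (auto simp: lip_seminorm_def intro!: SUP_mono) (force simp: abs_minus_commute)
  qed
  from le[of I g] le[of "uminus ` I" "\<lambda>x. g (- x)"] show ?thesis by (simp add: image_image)
qed

section \<open>Lipschitz classes\<close>

lemma lip_seminorm_finite_eq:
  assumes "x\<^sub>0 \<in> I"
  shows "lip_seminorm \<omega> I (\<lambda>x. ereal (f x)) =
    (SUP (x, y)\<in>{(x, y). x \<in> I \<and> y \<in> I \<and> x \<noteq> y}.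
       \<bar>ereal (f x) - ereal (f y)\<bar> / ereal (\<omega> \<bar>x - y\<bar>))"
  using assms by (auto simp: lip_seminorm_def)

lemma lip_seminorm_nonneg:
  assumes "modulus_of_continuity \<omega>" "nondegenerate_interval I"
  shows "0 \<le> lip_seminorm \<omega> I g"
proof (cases "\<forall>x\<in>I. g x = \<infinity>")
  case False
  obtain a b where ab: "a \<in> I" "b \<in> I" "a < b" using assms by (auto simp: nondegenerate_interval_def)
  have "0 \<le> \<bar>g a - g b\<bar> / ereal (\<omega> \<bar>a - b\<bar>)"
    using modulus_pos[OF assms(1), of "\<bar>a - b\<bar>"] ab by (intro zero_le_divide_ereal) auto
  also have "\<dots> \<le> lip_seminorm \<omega> I g"
    using False ab by (auto simp: lip_seminorm_def intro!: SUP_upper2[of "(a, b)"])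
  finally show ?thesis .
qed (simp add: lip_seminorm_def)

text \<open>Moves from the extended-real seminorm to a real constant L; the case x = y, absent from
  the supremum, uses \<omega>(0) = 0.\<close>

lemma Lip_bound:
  assumes "modulus_of_continuity \<omega>" "nondegenerate_interval I" "f \<in> Lip \<omega> I"
  obtains L where "L \<ge> 0" "lip_seminorm \<omega> I (\<lambda>x. ereal (f x)) = ereal L"
    "\<And>x y. x \<in> I \<Longrightarrow> y \<in> I \<Longrightarrow> \<bar>f x - f y\<bar> \<le> L * \<omega> \<bar>x - y\<bar>"
proof -
  let ?N = "lip_seminorm \<omega> I (\<lambda>x. ereal (f x))"
  have N: "0 \<le> ?N" "?N < \<infinity>" using lip_seminorm_nonneg[OF assms(1,2)] assms(3)
    by (auto simp: Lip_def)
  then obtain L where L: "?N = ereal L" "L \<ge> 0" by (cases ?N) auto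
  have "\<bar>f x - f y\<bar> \<le> L * \<omega> \<bar>x - y\<bar>" if "x \<in> I" "y \<in> I" for x y
  proof (cases "x = y")
    case True
    then show ?thesis using modulus_zero[OF assms(1)] by simp
  next
    case False
    have p: "\<omega> \<bar>x - y\<bar> > 0" using modulus_pos[OF assms(1)] False by simp
    have "\<bar>ereal (f x) - ereal (f y)\<bar> / ereal (\<omega> \<bar>x - y\<bar>) \<le> ?N"
      unfolding lip_seminorm_finite_eq[OF that(1)]
      using that False by (intro SUP_upper2[of "(x, y)"]) auto
    then show ?thesis using p by (simp add: L field_simps)
  qed
  then show ?thesis using that L by blast
qed

lemma Lip_continuous:
  assumes "modulus_of_continuity \<omega>" "nondegenerate_interval I" "f \<in> Lip \<omega> I"
  shows "continuous_on I f"
proof -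
  obtain L where L: "L \<ge> 0" "\<And>x y. x \<in> I \<Longrightarrow> y \<in> I \<Longrightarrow> \<bar>f x - f y\<bar> \<le> L * \<omega> \<bar>x - y\<bar>"
    using Lip_bound[OF assms] by metis
  show ?thesis unfolding continuous_on_iff
  proof (intro ballI allI impI)
    fix x e :: real assume x: "x \<in> I" and e: "0 < e"
    \<comment> \<open>Dividing by L + 1 instead of L covers constant f, where L = 0.\<close>
    obtain r where r: "0 < r" "\<omega> r < e / (L + 1)"
      using modulus_small[OF assms(1), of "e / (L + 1)" 1] L(1) e by auto
    have "dist (f x') (f x) < e" if "x' \<in> I" "dist x' x < r" for x'
    proof -
      have "\<omega> \<bar>x' - x\<bar> \<le> \<omega> r"
        using that by (intro modulus_mono[OF assms(1)]) (auto simp: dist_real_def)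
      then have "L * \<omega> \<bar>x' - x\<bar> \<le> L * \<omega> r" using L(1) by (rule mult_left_mono)
      also have "\<dots> \<le> (L + 1) * \<omega> r"
        using modulus_nonneg[OF assms(1), of r] r(1) by (simp add: algebra_simps)
      also have "\<dots> < e" using r(2) L(1) by (simp add: field_simps)
      finally show ?thesis using L(2)[OF that(1) x] by (simp add: dist_real_def)
    qed
    then show "\<exists>d>0. \<forall>x'\<in>I. dist x' x < d \<longrightarrow> dist (f x') (f x) < e" using r(1) by blast
  qed
qed

text \<open>Composition with negation preserves both seminorms, hence every quotient in the
  supremum. It lets the lower bound assume an endpoint on the left.\<close>

lemma maximal_op_norm_reflect:
  assumes "modulus_of_continuity \<omega>" "nondegenerate_interval I"
  shows "maximal_op_norm \<omega> (uminus ` I) = maximal_op_norm \<omega> I"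
proof -
  have le: "maximal_op_norm \<omega> I \<le> maximal_op_norm \<omega> (uminus ` I)"
    if I: "nondegenerate_interval I" for I
    unfolding maximal_op_norm_def
  proof (rule SUP_mono)
    fix f assume f: "f \<in> {f \<in> Lip \<omega> I. lip_seminorm \<omega> I (\<lambda>x. ereal (f x)) \<noteq> 0}"
    have c: "continuous_on I f" using f Lip_continuous[OF assms(1) I] by auto
    let ?g = "\<lambda>x. f (- x)"
    have 1: "lip_seminorm \<omega> (uminus ` I) (\<lambda>x. ereal (?g x)) = lip_seminorm \<omega> I (\<lambda>x. ereal (f x))"
      by (rule lip_seminorm_reflect)
    have "enn2ereal (maximal_function (uminus ` I) ?g x) = enn2ereal (maximal_function I f (- x))" for x
      using maximal_function_reflect[OF c, of "- x"] by simp
    then have 2: "lip_seminorm \<omega> (uminus ` I) (\<lambda>x. enn2ereal (maximal_function (uminus ` I) ?g x)) =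
        lip_seminorm \<omega> I (\<lambda>x. enn2ereal (maximal_function I f x))"
      using lip_seminorm_reflect[of \<omega> I "\<lambda>x. enn2ereal (maximal_function I f x)"] by simp
    show "\<exists>g\<in>{f \<in> Lip \<omega> (uminus ` I). lip_seminorm \<omega> (uminus ` I) (\<lambda>x. ereal (f x)) \<noteq> 0}.
       lip_seminorm \<omega> I (\<lambda>x. enn2ereal (maximal_function I f x)) /
         lip_seminorm \<omega> I (\<lambda>x. ereal (f x))
       \<le> lip_seminorm \<omega> (uminus ` I) (\<lambda>x. enn2ereal (maximal_function (uminus ` I) g x)) /
         lip_seminorm \<omega> (uminus ` I) (\<lambda>x. ereal (g x))"
      using f 1 2 by (intro bexI[of _ ?g]) (auto simp: Lip_def)
  qed
  from le[OF assms(2)] le[OF nondegenerate_interval_reflect[OF assms(2)]]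
  show ?thesis by (simp add: image_image)
qed

section \<open>The upper bound\<close>

text \<open>Stretching \<open>J = (a, b)\<close> linearly to \<open>(a, y)\<close> moves the point of parameter \<open>u \<in> (0, 1)\<close>
  by \<open>(y - b) u\<close>, so the two averages differ by at most the mean of \<open>\<omega>\<close> over \<open>(0, y - b)\<close>.\<close>

lemma maximal_function_diff_left:
  assumes \<omega>: "modulus_of_continuity \<omega>" and I: "is_interval I" "continuous_on I f"
    and L: "L \<ge> 0" "\<And>x y. x \<in> I \<Longrightarrow> y \<in> I \<Longrightarrow> \<bar>f x - f y\<bar> \<le> L * \<omega> \<bar>x - y\<bar>"
    and K: "K \<ge> 0"
      "\<And>t. 0 < t \<Longrightarrow> ennreal t < emeasure lborel I \<Longrightarrow> integral {0..1} (\<lambda>u. \<omega> (t * u)) \<le> K * \<omega> t"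
    and xy: "x \<in> I" "y \<in> I" "x < y"
  shows "maximal_function I f x \<le> maximal_function I f y + ennreal (L * K * \<omega> (y - x))"
proof (rule maximal_function_le[OF I(2)])
  fix a b J
  assume J: "a < b" "{a<..<b} \<subseteq> J" "J \<subseteq> {a..b}" "x \<in> J" "J \<subseteq> I"
  show "(\<integral>\<^sup>+u\<in>{0<..<1}. ennreal \<bar>f (a + (b - a) * u)\<bar> \<partial>lborel)
        \<le> maximal_function I f y + ennreal (L * K * \<omega> (y - x))"
  proof (cases "y \<in> J")
    case True
    then show ?thesis using maximal_function_ge[OF J(1-3) True J(5) I(2)]
      by (simp add: add_increasing2)
  next
    case False
    have axb: "a \<le> x" "x \<le> b" using J by auto
    have by': "b \<le> y"
    proof (rule ccontr)
      assume "\<not> b \<le> y"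
      then have "y \<in> {a<..<b}" using axb(1) xy(3) by auto
      then show False using J(2) False by blast
    qed
    have ay: "a < y" using J(1) by' by simp
    have inI: "z \<in> I" if "a < z" "z \<le> y" for z
    proof (cases "z < b")
      case True
      then show ?thesis using that J by auto
    next
      case False
      then show ?thesis using that axb I(1) xy(1,2) unfolding is_interval_1 by (meson not_less order_trans)
    qed
    have inI': "a + l * u \<in> I" if "0 < u" "u < 1" "0 < l" "a + l \<le> y" for l u
    proof -
      have "0 < l * u" "l * u < l * 1" using that by (simp_all only: mult_pos_pos mult_less_cancel_left_pos)
      then show ?thesis using that(4) by (intro inI) linarith+
    qed
    \<comment> \<open>The comparison interval is (a, y]: it must contain y, but a itself may lie
      outside I.\<close>
    define A where "A = (\<integral>\<^sup>+u\<in>{0<..<1}. ennreal \<bar>f (a + (y - a) * u)\<bar> \<partial>lborel)"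
    have A: "A \<le> maximal_function I f y" unfolding A_def
      using inI by (intro maximal_function_ge[OF ay _ _ _ _ I(2), of "{a<..y}"]) (use ay in auto)
    define t where "t = y - b"
    have t: "0 \<le> t" "t \<le> y - x" using by' axb by (auto simp: t_def)
    have mean: "integral {0..1} (\<lambda>u. \<omega> (t * u)) \<le> K * \<omega> (y - x)"
    \<comment> \<open>The hypothesis on K speaks only of t > 0; when b = y nothing moves and the
      mean is 0.\<close>
    proof (cases "t = 0")
      case True
      then show ?thesis using modulus_zero[OF \<omega>] K(1) modulus_nonneg[OF \<omega>, of "y - x"] xy(3) by simp
    next
      case False
      \<comment> \<open>Strictness comes from a < b, so t is admissible even if (a, y] fills all of
        I up to endpoints.\<close>
      have "ennreal t < ennreal (y - a)" using t J(1) by (auto simp: t_def ennreal_less_iff)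
      also have "\<dots> = emeasure lborel {a<..y}" using ay by simp
      also have "\<dots> \<le> emeasure lborel I"
        using inI real_interval_borel_measurable[OF I(1)] by (intro emeasure_mono) auto
      finally have "integral {0..1} (\<lambda>u. \<omega> (t * u)) \<le> K * \<omega> t" using K(2) t False by simp
      also have "\<dots> \<le> K * \<omega> (y - x)" using t K(1) by (intro mult_left_mono modulus_mono[OF \<omega>])
      finally show ?thesis .
    qed
    have "\<bar>f (a + (b - a) * u)\<bar> \<le> \<bar>f (a + (y - a) * u)\<bar> + L * \<omega> (t * u)" if u: "0 < u" "u < 1" for u
    proof -
      have "a + (b - a) * u \<in> I" "a + (y - a) * u \<in> I"
        using u J(1) ay by' by (auto intro!: inI')
      note L(2)[OF this]
      also have "\<bar>(a + (b - a) * u) - (a + (y - a) * u)\<bar> = t * u"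
        using t u by (simp add: t_def algebra_simps abs_if)
      finally show ?thesis by linarith
    qed
    then have "(\<integral>\<^sup>+u\<in>{0<..<1}. ennreal \<bar>f (a + (b - a) * u)\<bar> \<partial>lborel) \<le>
      (\<integral>\<^sup>+u. ennreal \<bar>f (a + (y - a) * u)\<bar> * indicator {0<..<1} u +
         ennreal (L * \<omega> (t * u)) * indicator {0<..<1} u \<partial>lborel)"
      using L(1) t modulus_nonneg[OF \<omega>]
      by (intro nn_integral_mono)
         (auto simp: indicator_def ennreal_plus[symmetric] simp del: ennreal_plus intro!: ennreal_leI)
    also have "\<dots> = A + (\<integral>\<^sup>+u\<in>{0<..<1}. ennreal (L * \<omega> (t * u)) \<partial>lborel)"
      unfolding A_def
    proof (intro nn_integral_add)
      have "continuous_on {0<..<1} (\<lambda>u. f (a + (y - a) * u))"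
      proof (rule continuous_on_compose2[OF I(2)])
        show "(\<lambda>u. a + (y - a) * u) ` {0<..<1} \<subseteq> I"
          using ay by (auto intro!: inI')
      qed (intro continuous_intros)
      then show "(\<lambda>u. ennreal \<bar>f (a + (y - a) * u)\<bar> * indicator {0<..<1} u) \<in> borel_measurable lborel"
        using borel_measurable_abs_indicator[of "{0<..<1}"] by simp
      have "continuous_on {0<..<1} (\<lambda>u. L * \<omega> (t * u))"
        by (intro continuous_intros continuous_on_subset[OF modulus_scaled_continuous[OF \<omega> t(1)]]) auto
      from borel_measurable_abs_indicator[OF _ this]
      have "(\<lambda>u. ennreal \<bar>L * \<omega> (t * u)\<bar> * indicator {0<..<1} u) \<in> borel_measurable lborel" by simp
      also have "(\<lambda>u. ennreal \<bar>L * \<omega> (t * u)\<bar> * indicator {0<..<1} u) =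
          (\<lambda>u. ennreal (L * \<omega> (t * u)) * indicator {0<..<1} u)"
        using L(1) t modulus_nonneg[OF \<omega>] by (auto simp: indicator_def fun_eq_iff)
      finally show "(\<lambda>u. ennreal (L * \<omega> (t * u)) * indicator {0<..<1} u) \<in> borel_measurable lborel" .
    qed
    also have "\<dots> \<le> maximal_function I f y + ennreal (L * K * \<omega> (y - x))"
    proof (rule add_mono[OF A])
      have "(\<integral>\<^sup>+u\<in>{0<..<1}. ennreal (L * \<omega> (t * u)) \<partial>lborel) =
          ennreal (integral {0..1} (\<lambda>u. L * \<omega> (t * u)))"
        using L(1) t modulus_nonneg[OF \<omega>]
        by (intro nn_integral_unit_interval continuous_intros modulus_scaled_continuous[OF \<omega>]) auto
      also have "\<dots> \<le> ennreal (L * K * \<omega> (y - x))"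
        using mean L(1) by (intro ennreal_leI) (simp add: mult.assoc mult_left_mono)
      finally show "(\<integral>\<^sup>+u\<in>{0<..<1}. ennreal (L * \<omega> (t * u)) \<partial>lborel)
          \<le> ennreal (L * K * \<omega> (y - x))" .
    qed
    finally show ?thesis .
  qed
qed

text \<open>The case y < x is the one-sided estimate on -I, whose length is that of I.\<close>

lemma maximal_function_diff:
  assumes \<omega>: "modulus_of_continuity \<omega>" and I: "is_interval I" "continuous_on I f"
    and L: "L \<ge> 0" "\<And>x y. x \<in> I \<Longrightarrow> y \<in> I \<Longrightarrow> \<bar>f x - f y\<bar> \<le> L * \<omega> \<bar>x - y\<bar>"
    and K: "K \<ge> 0"
      "\<And>t. 0 < t \<Longrightarrow> ennreal t < emeasure lborel I \<Longrightarrow> integral {0..1} (\<lambda>u. \<omega> (t * u)) \<le> K * \<omega> t"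
    and xy: "x \<in> I" "y \<in> I"
  shows "maximal_function I f x \<le> maximal_function I f y + ennreal (L * K * \<omega> \<bar>x - y\<bar>)"
proof (rule linorder_cases[of x y])
  assume "x < y"
  then show ?thesis
    using maximal_function_diff_left[OF \<omega> I L(1) _ K(1) _ xy] L(2) K(2) by (simp add: abs_if)
next
  assume "x = y"
  then show ?thesis by (simp add: add_increasing2)
next
  assume yx: "y < x"
  have c: "continuous_on (uminus ` I) (\<lambda>y. f (- y))"
    by (rule continuous_on_compose2[OF I(2)]) (auto intro!: continuous_intros)
  have i: "is_interval (uminus ` I)" using I(1) by simp
  have "maximal_function (uminus ` I) (\<lambda>y. f (- y)) (- x) \<le>
      maximal_function (uminus ` I) (\<lambda>y. f (- y)) (- y) + ennreal (L * K * \<omega> (- y - - x))"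
  proof (rule maximal_function_diff_left[OF \<omega> i c L(1) _ K(1)])
    show "\<bar>f (- x) - f (- y)\<bar> \<le> L * \<omega> \<bar>x - y\<bar>" if "x \<in> uminus ` I" "y \<in> uminus ` I" for x y
      using L(2)[of "- x" "- y"] that unfolding mem_uminus_image by (simp add: abs_minus_commute)
  qed (use xy yx K(2) emeasure_lborel_reflect[OF real_interval_borel_measurable[OF I(1)]] in auto)
  then show ?thesis using yx by (simp add: maximal_function_reflect[OF I(2)])
qed

lemma maximal_op_norm_le:
  assumes \<omega>: "modulus_of_continuity \<omega>" and I: "nondegenerate_interval I"
    and K: "K \<ge> 0"
      "\<And>t. 0 < t \<Longrightarrow> ennreal t < emeasure lborel I \<Longrightarrow> integral {0..1} (\<lambda>u. \<omega> (t * u)) \<le> K * \<omega> t"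
  shows "maximal_op_norm \<omega> I \<le> ereal K"
  unfolding maximal_op_norm_def
proof (rule SUP_least)
  fix f assume f: "f \<in> {f \<in> Lip \<omega> I. lip_seminorm \<omega> I (\<lambda>x. ereal (f x)) \<noteq> 0}"
  then have fL: "f \<in> Lip \<omega> I" by simp
  obtain L where L: "L \<ge> 0" "lip_seminorm \<omega> I (\<lambda>x. ereal (f x)) = ereal L"
    "\<And>x y. x \<in> I \<Longrightarrow> y \<in> I \<Longrightarrow> \<bar>f x - f y\<bar> \<le> L * \<omega> \<bar>x - y\<bar>"
    using Lip_bound[OF \<omega> I fL] by metis
  have Lpos: "L > 0" using f L(1,2) by (auto simp: less_le)
  have i: "is_interval I" using I by (simp add: nondegenerate_interval_def)
  have diff: "maximal_function I f x \<le> maximal_function I f y + ennreal (L * K * \<omega> \<bar>x - y\<bar>)"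
    if "x \<in> I" "y \<in> I" for x y
    by (rule maximal_function_diff[OF \<omega> i Lip_continuous[OF \<omega> I fL] L(1) _ K(1) _ that])
       (use L(3) K(2) in auto)
  let ?M = "\<lambda>x. enn2ereal (maximal_function I f x)"
  have "lip_seminorm \<omega> I ?M \<le> ereal (L * K)"
  proof (cases "\<forall>x\<in>I. ?M x = \<infinity>")
    case True
    then show ?thesis using L(1) K(1) by (simp add: lip_seminorm_def)
  next
    case False
    then obtain z where z: "z \<in> I" "maximal_function I f z \<noteq> \<infinity>" by auto
    \<comment> \<open>The difference bound propagates finiteness from z to all of I, so Mf is either
      identically infinite, with seminorm 0 by convention, or real-valued.\<close>
    have fin: "maximal_function I f x \<noteq> \<infinity>" if "x \<in> I" for x
      using diff[OF that z(1)] z(2) by (auto simp: top_unique)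
    have "\<bar>?M x - ?M y\<bar> / ereal (\<omega> \<bar>x - y\<bar>) \<le> ereal (L * K)" if xy: "x \<in> I" "y \<in> I" "x \<noteq> y" for x y
    proof -
      obtain p q where p: "maximal_function I f x = ennreal p" "p \<ge> 0"
        and q: "maximal_function I f y = ennreal q" "q \<ge> 0"
        using fin xy by (metis ennreal_cases infinity_ennreal_def)
      have w: "\<omega> \<bar>x - y\<bar> > 0" using modulus_pos[OF \<omega>] xy by simp
      then have e: "0 \<le> L * K * \<omega> \<bar>x - y\<bar>" using L(1) K(1) by simp
      have "p \<le> q + L * K * \<omega> \<bar>x - y\<bar>" "q \<le> p + L * K * \<omega> \<bar>x - y\<bar>"
        using diff[of x y] diff[of y x] xy p q e
        by (auto simp: ennreal_plus[symmetric] abs_minus_commute simp del: ennreal_plus)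
      then have "\<bar>p - q\<bar> \<le> L * K * \<omega> \<bar>x - y\<bar>" by linarith
      then show ?thesis using w p q by (simp add: enn2ereal_ennreal field_simps)
    qed
    then show ?thesis using False by (auto simp: lip_seminorm_def intro!: SUP_least)
  qed
  then show "lip_seminorm \<omega> I ?M / lip_seminorm \<omega> I (\<lambda>x. ereal (f x)) \<le> ereal K"
    using Lpos by (simp add: L(2) ereal_divide_le_pos)
qed

section \<open>The lower bound\<close>

text \<open>The extremal function \<open>\<omega> t - \<omega> (min \<bar>s - c\<bar> t)\<close> decreases away from the endpoint \<open>c\<close>.  Near \<open>c\<close>
  its maximal function is at least the value \<open>\<omega> t - \<omega> r\<close> at \<open>s = c + r\<close>, and at \<open>c + t\<close> it is the average
  over \<open>(c, c + t)\<close>; properness of \<open>I\<close> is needed for such an endpoint (up to reflection) to exist.\<close>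

lemma maximal_op_norm_ge_bdd_below:
  assumes \<omega>: "modulus_of_continuity \<omega>" and I: "nondegenerate_interval I" "bdd_below I"
    and t: "0 < t" "ennreal t < emeasure lborel I"
  shows "ereal (1 / \<omega> t * integral {0..1} (\<lambda>u. \<omega> (t * u))) \<le> maximal_op_norm \<omega> I"
proof -
  have i: "is_interval I" and ne: "I \<noteq> {}" using I by (auto simp: nondegenerate_interval_def)
  define c where "c = Inf I"
  have c: "c \<le> z" if "z \<in> I" for z using that I(2) by (simp add: c_def cInf_lower)
  \<comment> \<open>A point of I beyond c + t puts all of (c, c + t] inside I, whether or not the
    ends of I belong to it.\<close>
  have "\<exists>z\<in>I. c + t < z"
  proof (rule ccontr)
    assume "\<not> ?thesis"
    then have "I \<subseteq> {c..c + t}" using c by force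
    then have "emeasure lborel I \<le> emeasure lborel {c..c + t}" by (intro emeasure_mono) auto
    then show False using t by simp
  qed
  then obtain z where z: "z \<in> I" "c + t < z" by blast
  have inI: "s \<in> I" if s: "c < s" "s \<le> c + t" for s
  proof -
    obtain p where "p \<in> I" "p < s"
      using cInf_lessD[OF ne, of s] s(1) unfolding c_def by blast
    then show ?thesis using i z s unfolding is_interval_1 by (meson less_imp_le order_trans)
  qed
  \<comment> \<open>The cut-off at t keeps f nonnegative, so absolute values drop out of the
    averages; |s - c| makes the modulus estimate hold on the whole line.\<close>
  define f where "f = (\<lambda>s. \<omega> t - \<omega> (min \<bar>s - c\<bar> t))"
  define m where "m = integral {0..1} (\<lambda>u. \<omega> (t * u))"
  define N where "N = lip_seminorm \<omega> I (\<lambda>x. ereal (f x))"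
  define M where "M = lip_seminorm \<omega> I (\<lambda>x. enn2ereal (maximal_function I f x))"
  have wt: "\<omega> t > 0" by (rule modulus_pos[OF \<omega> t(1)])
  have m: "0 \<le> m" "m \<le> \<omega> t" using modulus_mean_bounds[OF \<omega>, of t] t(1) by (auto simp: m_def)
  have yI: "c + t \<in> I" using inI t(1) by simp
  have lip: "\<bar>f x - f y\<bar> \<le> \<omega> \<bar>x - y\<bar>" for x y
  proof -
    have "\<bar>f x - f y\<bar> \<le> \<omega> \<bar>min \<bar>x - c\<bar> t - min \<bar>y - c\<bar> t\<bar>"
      using modulus_diff_le[OF \<omega>, of "min \<bar>x - c\<bar> t" "min \<bar>y - c\<bar> t"] t(1)
      by (simp add: f_def abs_minus_commute)
    also have "\<dots> \<le> \<omega> \<bar>x - y\<bar>" by (intro modulus_mono[OF \<omega>]) auto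
    finally show ?thesis .
  qed
  have "\<bar>ereal (f x) - ereal (f y)\<bar> / ereal (\<omega> \<bar>x - y\<bar>) \<le> 1" if "x \<noteq> y" for x y
    using lip[of x y] modulus_pos[OF \<omega>, of "\<bar>x - y\<bar>"] that by (simp add: field_simps)
  then have N1: "N \<le> 1" unfolding N_def lip_seminorm_finite_eq[OF yI] by (auto intro!: SUP_least)
  then have fL: "f \<in> Lip \<omega> I" by (auto simp: Lip_def N_def)
  have cont: "continuous_on I f" by (rule Lip_continuous[OF \<omega> I(1) fL])
  have f_near: "f (c + r) = \<omega> t - \<omega> r" if "0 \<le> r" "r \<le> t" for r
    using that by (simp add: f_def)
  have f_nonneg: "0 \<le> f s" for s
    using modulus_mono[OF \<omega>, of "min \<bar>s - c\<bar> t" t] t(1) by (simp add: f_def)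
  have f_antimono: "f s' \<le> f s" if "c \<le> s" "s \<le> s'" for s s'
    using modulus_mono[OF \<omega>, of "min \<bar>s - c\<bar> t" "min \<bar>s' - c\<bar> t"] that t(1) by (simp add: f_def)
  have far: "maximal_function I f (c + t) \<le> ennreal (\<omega> t - m)"
  proof (rule maximal_function_le[OF cont])
    fix a b J
    assume J: "a < b" "{a<..<b} \<subseteq> J" "J \<subseteq> {a..b}" "c + t \<in> J" "J \<subseteq> I"
    have ac: "c \<le> a"
    proof (rule ccontr)
      assume "\<not> c \<le> a"
      then obtain s where "a < s" "s < min b c" using J(1) dense[of a "min b c"] by auto
      then have "s \<in> I" using J(2,5) by (auto dest!: subsetD[of "{a<..<b}" _ s])
      then show False using c[of s] \<open>s < min b c\<close> by auto
    qed
    have "f (a + (b - a) * u) \<le> \<omega> t - \<omega> (t * u)" if u: "0 < u" "u < 1" for u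
    proof -
      \<comment> \<open>Since c <= a and c + t <= b, the convex combination a (1 - u) + b u is at
        least c (1 - u) + (c + t) u = c + t u. Hence (c, c + t) gives the largest average, f being
        nonincreasing to the right of c.\<close>
      have "c * (1 - u) \<le> a * (1 - u)" using ac u by (intro mult_right_mono) auto
      moreover have "(c + t) * u \<le> b * u" using J(3,4) u by (intro mult_right_mono) auto
      ultimately have "c + t * u \<le> a + (b - a) * u" by (simp add: algebra_simps)
      then have "f (a + (b - a) * u) \<le> f (c + t * u)" using u t(1) by (intro f_antimono) auto
      also have "\<dots> = \<omega> t - \<omega> (t * u)" using u t(1) by (intro f_near) (auto simp: mult_left_le)
      finally show ?thesis .
    qed
    then have "(\<integral>\<^sup>+u\<in>{0<..<1}. ennreal \<bar>f (a + (b - a) * u)\<bar> \<partial>lborel) \<le>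
        (\<integral>\<^sup>+u\<in>{0<..<1}. ennreal (\<omega> t - \<omega> (t * u)) \<partial>lborel)"
      using f_nonneg by (intro nn_integral_mono) (auto simp: indicator_def intro!: ennreal_leI)
    also have "\<dots> = ennreal (integral {0..1} (\<lambda>u. \<omega> t - \<omega> (t * u)))"
      using t(1) modulus_mono[OF \<omega>]
      by (intro nn_integral_unit_interval continuous_intros modulus_scaled_continuous[OF \<omega>])
         (auto simp: mult_left_le)
    also have "integral {0..1} (\<lambda>u. \<omega> t - \<omega> (t * u)) = \<omega> t - m"
      unfolding m_def using modulus_scaled_continuous[OF \<omega>, of t] t(1)
      by (subst integral_diff) (auto intro!: integrable_continuous_real)
    finally show "(\<integral>\<^sup>+u\<in>{0<..<1}. ennreal \<bar>f (a + (b - a) * u)\<bar> \<partial>lborel) \<le> ennreal (\<omega> t - m)" .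
  qed
  \<comment> \<open>The point c + r replaces c, which may not belong to I; on (c, c + r] the
    function is at least its value at the right end.\<close>
  have near: "ennreal (\<omega> t - \<omega> r) \<le> maximal_function I f (c + r)" if r: "0 < r" "r < t" for r
  proof -
    have "ennreal (\<omega> t - \<omega> r) = (\<integral>\<^sup>+u\<in>{0<..<1::real}. ennreal (\<omega> t - \<omega> r) \<partial>lborel)"
      by (simp add: nn_integral_cmult_indicator)
    also have "\<dots> \<le> (\<integral>\<^sup>+u\<in>{0<..<1}. ennreal \<bar>f (c + (c + r - c) * u)\<bar> \<partial>lborel)"
    proof (intro nn_integral_mono)
      fix u :: real
      show "ennreal (\<omega> t - \<omega> r) * indicator {0<..<1} u
          \<le> ennreal \<bar>f (c + (c + r - c) * u)\<bar> * indicator {0<..<1} u"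
      proof (cases "u \<in> {0<..<1}")
        case True
        then have "f (c + r) \<le> f (c + r * u)" using r by (intro f_antimono) (auto simp: mult_left_le)
        then show ?thesis using True r f_near[of r] by (auto intro!: ennreal_leI)
      qed simp
    qed
    also have "\<dots> \<le> maximal_function I f (c + r)"
      using r inI by (intro maximal_function_ge[OF _ _ _ _ _ cont, of _ _ "{c<..c + r}"]) auto
    finally show ?thesis .
  qed
  obtain q where q: "maximal_function I f (c + t) = ennreal q" "0 \<le> q" "q \<le> \<omega> t - m"
    using far m by (metis ennreal_cases ennreal_le_iff ennreal_less_top diff_ge_0_iff_ge leD top.not_eq_extremum)
  have "ereal (m / \<omega> t) \<le> M"
  proof (rule ereal_le_epsilon2)
    fix e :: real assume e: "0 < e"
    \<comment> \<open>With this r the numerator is at least m - \<omega>(r), and \<omega>(r) costs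
      less than e after division by \<omega>(t). The true denominator \<omega>(t - r) is no larger
      than \<omega>(t), which only helps.\<close>
    obtain r where r: "0 < r" "r < t" "\<omega> r < e * \<omega> t"
      using modulus_small[OF \<omega>, of "e * \<omega> t" t] e wt t(1) by auto
    have wp: "0 < \<omega> (t - r)" "\<omega> (t - r) \<le> \<omega> t"
      using r by (auto intro!: modulus_pos[OF \<omega>] modulus_mono[OF \<omega>])
    let ?Q = "\<bar>enn2ereal (maximal_function I f (c + r)) - enn2ereal (maximal_function I f (c + t))\<bar> /
          ereal (\<omega> \<bar>(c + r) - (c + t)\<bar>)"
    have abs: "\<bar>(c + r) - (c + t)\<bar> = t - r" using r by simp
    have "ereal (m / \<omega> t - e) \<le> ?Q"
    proof (cases "maximal_function I f (c + r)")
      case (real p)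
      then have p: "\<omega> t - \<omega> r \<le> p" using near[OF r(1,2)] by simp
      have "m / \<omega> t - e \<le> (m - \<omega> r) / \<omega> t" using r(3) wt by (simp add: field_simps)
      also have "\<dots> \<le> \<bar>p - q\<bar> / \<omega> t" using p q wt by (intro divide_right_mono) auto
      also have "\<dots> \<le> \<bar>p - q\<bar> / \<omega> (t - r)" using wp by (intro divide_left_mono) auto
      finally show ?thesis unfolding abs using real q wp by (simp add: enn2ereal_ennreal)
    next
      case top
      then show ?thesis unfolding abs using q wp by (simp add: enn2ereal_ennreal)
    qed
    also have "?Q \<le> M"
    proof -
      have "\<not> (\<forall>x\<in>I. enn2ereal (maximal_function I f x) = \<infinity>)"
        using q yI by (force simp: enn2ereal_ennreal)
      then show ?thesis unfolding M_def lip_seminorm_def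
        using yI inI[of "c + r"] r by (auto intro!: SUP_upper2[of "(c + r, c + t)"])
    qed
    finally show "ereal (m / \<omega> t) \<le> M + ereal e" by (cases M) auto
  qed
  moreover have "M \<le> maximal_op_norm \<omega> I"
  proof -
    obtain r where r: "0 < r" "r < t" "\<omega> r < \<omega> t" using modulus_small[OF \<omega> wt t(1)] by blast
    have "0 < \<bar>ereal (f (c + r)) - ereal (f (c + t))\<bar> / ereal (\<omega> \<bar>(c + r) - (c + t)\<bar>)"
      using r modulus_pos[OF \<omega>, of "t - r"] f_near[of r] f_near[of t] by simp
    also have "\<dots> \<le> N" unfolding N_def lip_seminorm_finite_eq[OF yI]
      using r yI inI[of "c + r"] by (intro SUP_upper2[of "(c + r, c + t)"]) auto
    finally have N0: "0 < N" .
    have "0 \<le> M" unfolding M_def by (rule lip_seminorm_nonneg[OF \<omega> I(1)])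
    then have "N * M \<le> 1 * M" using N1 by (intro ereal_mult_right_mono)
    then have "M \<le> M / N" using N0 N1 by (subst ereal_le_divide_pos) auto
    also have "\<dots> \<le> maximal_op_norm \<omega> I"
      unfolding maximal_op_norm_def M_def N_def
      using fL N0 by (intro SUP_upper) (auto simp: N_def)
    finally show ?thesis .
  qed
  ultimately show ?thesis by (simp add: m_def)
qed

text \<open>If I misses z but is unbounded below, it has a point below z, so by convexity it lies
  entirely below z; the reflected interval is then bounded below.\<close>

lemma maximal_op_norm_ge:
  assumes \<omega>: "modulus_of_continuity \<omega>" and I: "proper_subinterval I"
    and t: "0 < t" "ennreal t < emeasure lborel I"
  shows "ereal (1 / \<omega> t * integral {0..1} (\<lambda>u. \<omega> (t * u))) \<le> maximal_op_norm \<omega> I"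
proof -
  have nd: "nondegenerate_interval I" and i: "is_interval I" and "I \<noteq> UNIV"
    using I by (auto simp: proper_subinterval_def nondegenerate_interval_def)
  then obtain z where z: "z \<notin> I" by blast
  show ?thesis
  proof (cases "bdd_below I")
    case True
    then show ?thesis by (intro maximal_op_norm_ge_bdd_below[OF \<omega> nd _ t])
  next
    case False
    then obtain p where p: "p \<in> I" "p < z" by (meson bdd_below.I not_le)
    have "x \<le> z" if "x \<in> I" for x
      using i p z that unfolding is_interval_1 by (meson less_imp_le not_le)
    then have "bdd_below (uminus ` I)" by (intro bdd_belowI[of _ "- z"]) auto
    moreover have "emeasure lborel (uminus ` I) = emeasure lborel I"
      by (intro emeasure_lborel_reflect real_interval_borel_measurable i)
    ultimately show ?thesis
      using maximal_op_norm_ge_bdd_below[OF \<omega> nondegenerate_interval_reflect[OF nd], of t] t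
        maximal_op_norm_reflect[OF \<omega> nd] by simp
  qed
qed

section \<open>The supremum formula and its power case\<close>

text \<open>Ensures a nonempty index set; an empty supremum of extended reals would be minus
  infinity.\<close>

lemma nondegenerate_interval_length_pos:
  assumes "nondegenerate_interval I"
  obtains t where "0 < t" "ennreal t < emeasure lborel I"
proof -
  obtain a b where ab: "a \<in> I" "b \<in> I" "a < b" and i: "is_interval I"
    using assms by (auto simp: nondegenerate_interval_def)
  have "{a..b} \<subseteq> I" using ab i unfolding is_interval_1 by (meson atLeastAtMost_iff subsetI)
  then have "emeasure lborel {a..b} \<le> emeasure lborel I"
    using real_interval_borel_measurable[OF i] by (intro emeasure_mono) auto
  moreover have "ennreal ((b - a) / 2) < ennreal (b - a)" using ab by (simp add: ennreal_less_iff)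
  ultimately show ?thesis using that[of "(b - a) / 2"] ab by auto
qed

lemma maximal_op_norm_eq:
  assumes \<omega>: "modulus_of_continuity \<omega>" and I: "proper_subinterval I"
  shows "maximal_op_norm \<omega> I =
    (SUP t\<in>{t::real. 0 < t \<and> ennreal t < emeasure lborel I}.
       ereal (1 / \<omega> t * integral {0..1} (\<lambda>u. \<omega> (t * u))))"
proof (rule antisym)
  let ?T = "{t::real. 0 < t \<and> ennreal t < emeasure lborel I}"
  let ?h = "\<lambda>t. 1 / \<omega> t * integral {0..1} (\<lambda>u. \<omega> (t * u))"
  let ?S = "SUP t\<in>?T. ereal (?h t)"
  have nd: "nondegenerate_interval I" using I by (simp add: proper_subinterval_def)
  obtain t where t: "t \<in> ?T" using nondegenerate_interval_length_pos[OF nd] by blast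
  have h: "0 \<le> ?h t" "?h t \<le> 1" if "t > 0" for t
    using modulus_mean_bounds[OF \<omega>, of t] modulus_pos[OF \<omega> that] that by auto
  have "0 \<le> ?S" using h(1)[of t] t by (intro SUP_upper2[OF t]) auto
  moreover have "?S \<le> 1" using h(2) by (intro SUP_least) auto
  \<comment> \<open>The supremum itself, now known to be real, serves as the constant K of the upper
    bound.\<close>
  ultimately obtain K where K: "?S = ereal K" "K \<ge> 0" by (cases ?S) auto
  have "maximal_op_norm \<omega> I \<le> ereal K"
  proof (rule maximal_op_norm_le[OF \<omega> nd K(2)])
    fix t :: real assume t: "0 < t" "ennreal t < emeasure lborel I"
    have "ereal (?h t) \<le> ereal K" unfolding K(1)[symmetric] using t by (intro SUP_upper) auto
    then show "integral {0..1} (\<lambda>u. \<omega> (t * u)) \<le> K * \<omega> t"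
      using modulus_pos[OF \<omega> t(1)] by (simp add: field_simps)
  qed
  then show "maximal_op_norm \<omega> I \<le> ?S" by (simp only: K(1))
  show "?S \<le> maximal_op_norm \<omega> I" by (rule SUP_least) (use maximal_op_norm_ge[OF assms] in auto)
qed

text \<open>By homogeneity t cancels, leaving the integral of u to the power \<alpha> over
  [0, 1].\<close>

lemma powr_mean:
  fixes t \<alpha> :: real
  assumes "0 < t" "0 < \<alpha>"
  shows "1 / t powr \<alpha> * integral {0..1} (\<lambda>u. (t * u) powr \<alpha>) = 1 / (1 + \<alpha>)"
proof -
  have "((\<lambda>u. t powr \<alpha> * u powr \<alpha>) has_integral t powr \<alpha> * (1 powr (\<alpha> + 1) / (\<alpha> + 1))) {0..1}"
    using assms by (intro has_integral_mult_right has_integral_powr_from_0) auto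
  then have "((\<lambda>u. (t * u) powr \<alpha>) has_integral t powr \<alpha> / (1 + \<alpha>)) {0..1}"
    using assms(1) by (subst has_integral_cong[of _ _ "\<lambda>u. t powr \<alpha> * u powr \<alpha>"])
      (auto simp: powr_mult add.commute)
  from integral_unique[OF this] show ?thesis using assms(1) by simp
qed

theorem corollary4p5:
  fixes I :: "real set"
  assumes "proper_subinterval I"
  shows "(\<forall>\<omega>. modulus_of_continuity \<omega> \<longrightarrow>
            maximal_op_norm \<omega> I =
              (SUP t\<in>{t::real. 0 < t \<and> ennreal t < emeasure lborel I}.
                 ereal (1 / \<omega> t * integral {0..1} (\<lambda>u. \<omega> (t * u))))) \<and>
         (\<forall>\<alpha>::real. 0 < \<alpha> \<and> \<alpha> \<le> 1 \<longrightarrow>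
            maximal_op_norm (\<lambda>t. t powr \<alpha>) I = ereal (1 / (1 + \<alpha>)))"
proof (intro conjI allI impI)
  fix \<omega> assume "modulus_of_continuity \<omega>"
  then show "maximal_op_norm \<omega> I =
      (SUP t\<in>{t::real. 0 < t \<and> ennreal t < emeasure lborel I}.
         ereal (1 / \<omega> t * integral {0..1} (\<lambda>u. \<omega> (t * u))))"
    by (rule maximal_op_norm_eq[OF _ assms])
next
  fix \<alpha> :: real assume \<alpha>: "0 < \<alpha> \<and> \<alpha> \<le> 1"
  let ?T = "{t::real. 0 < t \<and> ennreal t < emeasure lborel I}"
  have "nondegenerate_interval I" using assms by (simp add: proper_subinterval_def)
  then obtain t where "t \<in> ?T" using nondegenerate_interval_length_pos by blast
  then have "?T \<noteq> {}" by blast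
  moreover have "maximal_op_norm (\<lambda>t. t powr \<alpha>) I =
      (SUP t\<in>?T. ereal (1 / t powr \<alpha> * integral {0..1} (\<lambda>u. (t * u) powr \<alpha>)))"
    using \<alpha> by (intro maximal_op_norm_eq modulus_powr assms) auto
  moreover have "\<dots> = (SUP t\<in>?T. ereal (1 / (1 + \<alpha>)))"
    by (rule SUP_cong[OF refl]) (use \<alpha> in \<open>simp only: powr_mean mem_Collect_eq\<close>)
  ultimately show "maximal_op_norm (\<lambda>t. t powr \<alpha>) I = ereal (1 / (1 + \<alpha>))" by simp
qed

end
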